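(* For every $n\in\mathbb{N}$ (positive integer) the following three double inequalities hold: $$\frac{1}{\sqrt{\pi\left(n+\frac{4}{\pi}-1\right)}}\le\frac{(2n-1)!!}{(2n)!!}<\frac{1}{\sqrt{\pi\left(n+\frac14\right)}},\qquad\text{(I)}$$ $$\frac{\sqrt{\pi}}{2\sqrt{n+\frac{9\pi}{16}-1}}\le\frac{(2n)!!}{(2n+1)!!}<\frac{\sqrt{\pi}}{2\sqrt{n+\frac34}},\qquad\text{(II)}$$ $$\frac{\sqrt{\pi}}{\sqrt{1+\left(\frac{9\pi}{16}-1\right)\frac1n}}\le\int_{-\sqrt{n}}^{\sqrt{n}}e^{-x^2}\,dx<\frac{\sqrt{\pi}}{\sqrt{1-\frac{3}{4n}}}.\qquad\text{(III)}$$ In particular, letting $n\to\infty$ in (III) gives $\int_{-\infty}^{\infty}e^{-x^2}\,dx=\sqrt{\pi}$. Moreover, the constants $\frac4\pi-1$ and $\frac14$ in (I), and the constants $\frac{9\pi}{16}-1$ and $\frac34$ in (II), are the best possible.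
   Context: $n!!$ denotes the double factorial: $(2n)!!=\prod_{k=1}^n 2k$ and $(2n-1)!!=\prod_{k=1}^n(2k-1)$. "Best possible" means: the constant in the lower bound (namely $\frac4\pi-1$ in (I), $\frac{9\pi}{16}-1$ in (II)) cannot be replaced by any smaller number, and the constant in the upper bound (namely $\frac14$ in (I), $\frac34$ in (II)) cannot be replaced by any larger number, with the corresponding inequality still holding for all $n\in\mathbb{N}$. *)

theory Defs
  imports "HOL-Analysis.Analysis"
begin

definition dfact :: "nat \<Rightarrow> nat" where
  "dfact m = (if even m then (\<Prod>k=1..m div 2. 2 * k) else (\<Prod>k=1..(m + 1) div 2. 2 * k - 1))"

lemma dfact_even: "dfact (2 * n) = (\<Prod>k=1..n. 2 * k)"
  by (simp add: dfact_def)

(* Truncated subtraction is harmless here: at n = 0 both sides are 1. *)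
lemma dfact_odd: "dfact (2 * n - 1) = (\<Prod>k=1..n. 2 * k - 1)"
proof (cases n)
  case 0
  then show ?thesis by (simp add: dfact_def)
next
  case (Suc m)
  then have "odd (2 * n - 1)" "2 * n - 1 + 1 = 2 * n" by auto
  then show ?thesis by (simp add: dfact_def)
qed

end

theory Submission
  imports Defs "HOL-Probability.Distributions"
begin

text \<open>
  Both quotients of double factorials have squares \<open>r\<close> with
  \<open>r (n + 1) = r n * ((2 n + s) / (2 n + s + 1))\<^sup>2\<close>, where \<open>s = 1\<close> or \<open>s = 2\<close>, and
  Wallis' product gives the limit \<open>L\<close> of \<open>n * r n\<close>. The increments of
  \<open>r n * (n + c)\<close> have the sign of an affine function of \<open>n\<close> with slope \<open>2 s - 1 - 4 c\<close>.
  At \<open>c = (2 s - 1) / 4\<close> the sequence is increasing, so it stays below \<open>L\<close>; for larger \<open>c\<close>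
  it first increases and then decreases to \<open>L\<close>, so it stays above the smaller of \<open>L\<close> and its
  first term. The lower constants are those for which the first term equals \<open>L\<close>.
  The bound for the Gaussian integral follows from \<open>(1 - x\<^sup>2 / n)\<^sup>n \<le> exp (- x\<^sup>2)\<close>.
\<close>

section \<open>Sequences with a Wallis-type recurrence\<close>

locale wallis_ratio =
  fixes r :: "nat \<Rightarrow> real" and s L :: real
  assumes s_pos: "0 < s"
    and r_pos: "0 < r n"
    and r_Suc: "r (Suc n) = r n * ((2 * real n + s) / (2 * real n + s + 1))\<^sup>2"
    and tendsto_r: "(\<lambda>n. real n * r n) \<longlonglongrightarrow> L"
begin

text \<open>Convergence of \<open>n * r n\<close> forces \<open>r n\<close> to tend to 0, so the
  extra term \<open>r n * c\<close> vanishes in the limit.\<close>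

lemma tendsto_shift: "(\<lambda>n. r n * (real n + c)) \<longlonglongrightarrow> L"
proof -
  have "(\<lambda>n. real n * r n * inverse (real n)) \<longlonglongrightarrow> L * 0"
    by (intro tendsto_mult tendsto_r lim_inverse_n)
  moreover have "\<forall>\<^sub>F n in sequentially. real n * r n * inverse (real n) = r n"
    using eventually_gt_at_top[of 0] by eventually_elim simp
  ultimately have "r \<longlonglongrightarrow> 0"
    using Lim_transform_eventually by fastforce
  then have "(\<lambda>n. real n * r n + r n * c) \<longlonglongrightarrow> L + 0 * c"
    by (intro tendsto_intros tendsto_r)
  then show ?thesis by (simp add: algebra_simps)
qed

text \<open>This is \<open>(2 n + s)^2 (n + 1 + c) - (2 n + s + 1)^2 (n + c)\<close> expanded; the
  quadratic terms in \<open>n\<close> cancel. It carries the sign of the increment of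
  \<open>r n * (n + c)\<close>.\<close>

definition drift :: "real \<Rightarrow> nat \<Rightarrow> real" where
  "drift c n = real n * (2 * s - 1 - 4 * c) + s\<^sup>2 - c * (2 * s + 1)"

lemma shift_Suc:
  "r (Suc n) * (real (Suc n) + c)
    = r n * (real n + c) + r n * drift c n / (2 * real n + s + 1)\<^sup>2"
proof -
  have nz: "(2 * real n + s + 1)\<^sup>2 \<noteq> 0"
    using s_pos by (simp add: add_nonneg_pos)
  have "(2 * real n + s)\<^sup>2 * (real (Suc n) + c)
      = (2 * real n + s + 1)\<^sup>2 * (real n + c) + drift c n"
    by (simp add: drift_def power2_eq_square algebra_simps)
  then have "r (Suc n) * (real (Suc n) + c)
      = r n * ((2 * real n + s + 1)\<^sup>2 * (real n + c) + drift c n) / (2 * real n + s + 1)\<^sup>2"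
    unfolding r_Suc power_divide by (simp only: times_divide_eq_right times_divide_eq_left mult.assoc)
  moreover have "x * (q * y + d) / q = x * y + x * d / q" if "q \<noteq> 0" for x y q d :: real
    using that by (simp add: field_simps)
  ultimately show ?thesis using nz by simp
qed

lemma shift_le_Suc: "drift c n \<ge> 0 \<Longrightarrow> r n * (real n + c) \<le> r (Suc n) * (real (Suc n) + c)"
  unfolding shift_Suc using r_pos[of n] by simp

lemma shift_ge_Suc: "drift c n \<le> 0 \<Longrightarrow> r (Suc n) * (real (Suc n) + c) \<le> r n * (real n + c)"
  unfolding shift_Suc using r_pos[of n] by (simp add: divide_nonpos_nonneg mult_nonneg_nonpos)

lemma drift_antimono:
  assumes "c \<ge> (2 * s - 1) / 4" "m \<le> n"
  shows "drift c n \<le> drift c m"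
  using assms by (simp add: drift_def mult_right_mono_neg)

text \<open>At this shift the slope of \<open>drift\<close> is 0 and its constant value 1/4 is
  positive, so the sequence increases strictly to its limit.\<close>

lemma shift_less: "r n * (real n + (2 * s - 1) / 4) < L"
proof -
  define c where "c = (2 * s - 1) / 4"
  define v where "v n = r n * (real n + c)" for n
  have drift: "drift c n = 1 / 4" for n
    unfolding drift_def c_def by (simp add: power2_eq_square field_simps)
  have inc: "v n < v (Suc n)" for n
    unfolding v_def shift_Suc drift using r_pos[of n] s_pos
    by (auto intro!: divide_pos_pos zero_less_power add_nonneg_pos)
  \<comment> \<open>One strict step is taken first, because passing to the limit only yields a weak
    inequality.\<close>
  have "v n < v (Suc n)" by (rule inc)
  also have "v (Suc n) \<le> L"
    using inc tendsto_shift[of c]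
    by (intro incseq_le) (auto simp: incseq_Suc_iff less_imp_le v_def)
  finally show ?thesis by (simp add: v_def c_def)
qed

text \<open>\<open>drift c\<close> is antitone, so once nonpositive it stays so; from
  \<open>n\<close> on the sequence decreases to \<open>L\<close> and hence lies above it.\<close>

lemma shift_ge_of_drift_nonpos:
  assumes c: "c \<ge> (2 * s - 1) / 4" and drift: "drift c n \<le> 0"
  shows "L \<le> r n * (real n + c)"
proof -
  define w where "w k = r (n + k) * (real (n + k) + c)" for k
  have "drift c (n + k) \<le> 0" for k
    using drift_antimono[OF c, of n "n + k"] drift by simp
  then have "decseq w"
    using shift_ge_Suc[of c "n + k" for k] by (simp add: decseq_Suc_iff w_def)
  moreover have "w = (\<lambda>k. r (k + n) * (real (k + n) + c))"
    by (simp add: w_def fun_eq_iff add.commute)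
  then have "w \<longlonglongrightarrow> L"
    using LIMSEQ_ignore_initial_segment[OF tendsto_shift[of c], of n] by simp
  ultimately have "L \<le> w 0" by (rule decseq_ge)
  then show ?thesis by (simp add: w_def)
qed

text \<open>While the drift is positive the sequence has only increased since index 1, so the bound
  is inherited from the first term; afterwards the decreasing tail gives it.\<close>

lemma shift_ge:
  assumes c: "c \<ge> (2 * s - 1) / 4" and init: "L \<le> r 1 * (1 + c)" and n: "n \<ge> 1"
  shows "L \<le> r n * (real n + c)"
proof (cases "drift c n \<le> 0")
  case True
  then show ?thesis by (rule shift_ge_of_drift_nonpos[OF c])
next
  case False
  from n show ?thesis using False
  proof (induction n rule: dec_induct)
    case base
    then show ?case using init by simp
  next
    case (step m)
    then have "drift c m \<ge> 0"
      using drift_antimono[OF c, of m "Suc m"] by simp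
    then have "r m * (real m + c) \<le> r (Suc m) * (real (Suc m) + c)"
      by (rule shift_le_Suc)
    moreover have "L \<le> r m * (real m + c)"
      using step.IH shift_ge_of_drift_nonpos[OF c, of m] by blast
    ultimately show ?case by linarith
  qed
qed

text \<open>Above the critical shift the slope of the drift is negative, so the drift is eventually
  nonpositive. Positivity of \<open>n + c\<close> is recorded because the square root bounds are
  translated only under it.\<close>

lemma ex_shift_ge:
  assumes "c > (2 * s - 1) / 4"
  shows "\<exists>n\<ge>1. real n + c > 0 \<and> L \<le> r n * (real n + c)"
proof -
  have "filterlim (\<lambda>n. (4 * c - (2 * s - 1)) * real n) at_top sequentially"
    using assms by (intro filterlim_tendsto_pos_mult_at_top[OF tendsto_const]
        filterlim_real_sequentially) simp
  then have "\<forall>\<^sub>F n in sequentially. s\<^sup>2 - c * (2 * s + 1) \<le> (4 * c - (2 * s - 1)) * real n"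
    by (simp add: filterlim_at_top)
  moreover have "\<forall>\<^sub>F n in sequentially. real n > - c"
    using filterlim_real_sequentially by (simp add: filterlim_at_top_dense)
  ultimately have "\<forall>\<^sub>F n in sequentially. n \<ge> 1 \<and> real n + c > 0 \<and> drift c n \<le> 0"
    using eventually_ge_at_top[of 1]
    by eventually_elim (auto simp: drift_def algebra_simps)
  then obtain n where "n \<ge> 1" "real n + c > 0" "drift c n \<le> 0"
    by (auto simp: eventually_sequentially)
  then show ?thesis
    using shift_ge_of_drift_nonpos[of c n] assms by auto
qed

text \<open>
  For \<open>c \<le> - 1\<close> the index \<open>1\<close> would not do: there \<open>n + c\<close> is not positive, and in the
  inequalities below the square root and the division take junk values.
\<close>

lemma ex_shift_less:
  assumes c: "c < C" and init: "r 1 * (1 + C) = L"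
  shows "\<exists>n\<ge>1. real n + c > 0 \<and> r n * (real n + c) < L"
proof (cases "c > - 1")
  case True
  have "r 1 * (1 + c) < L"
    using c init r_pos[of 1] by (metis add_strict_left_mono mult_strict_left_mono)
  with True show ?thesis by (intro exI[of _ 1]) auto
next
  case False
  obtain n where n: "real n > - c" using reals_Archimedean2 by blast
  \<comment> \<open>As \<open>s > 0\<close>, the critical shift exceeds -1/4 and hence
    \<open>c\<close>, so \<open>shift_less\<close> applies at any index with
    \<open>n + c > 0\<close>.\<close>
  have "r n * (real n + c) \<le> r n * (real n + (2 * s - 1) / 4)"
    using False s_pos r_pos[of n] by (intro mult_left_mono) auto
  with shift_less[of n] n False show ?thesis
    by (intro exI[of _ n]) auto
qed

end

section \<open>The two quotients of double factorials\<close>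

definition odd_even_ratio :: "nat \<Rightarrow> real" where
  "odd_even_ratio n = real (dfact (2 * n - 1)) / real (dfact (2 * n))"

definition even_odd_ratio :: "nat \<Rightarrow> real" where
  "even_odd_ratio n = real (dfact (2 * n)) / real (dfact (2 * n + 1))"

lemma dfact_pos: "dfact n > 0"
  by (auto simp: dfact_def odd_pos intro!: prod_pos)

lemma dfact_Suc_even: "dfact (2 * Suc n) = (2 * n + 2) * dfact (2 * n)"
  unfolding dfact_even by simp

lemma dfact_Suc_odd: "dfact (2 * n + 1) = (2 * n + 1) * dfact (2 * n - 1)"
  using dfact_odd[of "Suc n"] unfolding dfact_odd[of n] by simp

lemma odd_even_ratio_0: "odd_even_ratio 0 = 1"
  by (simp add: odd_even_ratio_def dfact_def)

lemma odd_even_ratio_pos: "odd_even_ratio n > 0"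
  by (simp add: odd_even_ratio_def dfact_pos)

lemma odd_even_ratio_Suc:
  "odd_even_ratio (Suc n) = odd_even_ratio n * ((2 * real n + 1) / (2 * real n + 2))"
proof -
  have "dfact (2 * Suc n - 1) = (2 * n + 1) * dfact (2 * n - 1)"
    using dfact_Suc_odd[of n] by simp
  then show ?thesis
    unfolding odd_even_ratio_def dfact_Suc_even by (simp only: of_nat_mult) (simp add: ac_simps)
qed

text \<open>This link lets a single Wallis limit serve both quotients.\<close>

lemma even_odd_ratio_eq: "even_odd_ratio n = 1 / ((2 * real n + 1) * odd_even_ratio n)"
  unfolding even_odd_ratio_def odd_even_ratio_def dfact_Suc_odd by (simp only: of_nat_mult) simp

lemma even_odd_ratio_0: "even_odd_ratio 0 = 1"
  by (simp add: even_odd_ratio_eq odd_even_ratio_0)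

lemma even_odd_ratio_pos: "even_odd_ratio n > 0"
  by (simp add: even_odd_ratio_eq odd_even_ratio_pos add_nonneg_pos)

lemma even_odd_ratio_Suc:
  "even_odd_ratio (Suc n) = even_odd_ratio n * ((2 * real n + 2) / (2 * real n + 3))"
proof -
  have "2 * real n + 1 \<noteq> 0" "2 * real n + 2 \<noteq> 0" "2 * real n + 3 \<noteq> 0" by linarith+
  then show ?thesis
    using odd_even_ratio_pos[of n]
    by (simp add: even_odd_ratio_eq odd_even_ratio_Suc field_simps)
qed

lemma odd_even_ratio_1: "odd_even_ratio (Suc 0) = 1 / 2"
  using odd_even_ratio_Suc[of 0] by (simp add: odd_even_ratio_0)

lemma even_odd_ratio_1: "even_odd_ratio (Suc 0) = 2 / 3"
  using even_odd_ratio_Suc[of 0] by (simp add: even_odd_ratio_0)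

section \<open>Wallis' product and the limits of the squared quotients\<close>

text \<open>Each factor is \<open>(2 k)^2 / ((2 k - 1) (2 k + 1))\<close>; the odd factors pair up
  to squares except for the last one, \<open>2 n + 1\<close>.\<close>

lemma wallis_product_eq:
  "(\<Prod>k=1..n. (4 * (real k)\<^sup>2) / (4 * (real k)\<^sup>2 - 1))
    = 1 / ((2 * real n + 1) * (odd_even_ratio n)\<^sup>2)"
proof (induction n)
  case 0
  then show ?case by (simp add: odd_even_ratio_0)
next
  case (Suc n)
  define x where "x = 2 * real n"
  define a where "a = odd_even_ratio n"
  have x: "x + 1 \<noteq> 0" "x + 2 \<noteq> 0" "x + 3 \<noteq> 0" by (simp_all add: x_def)
  have a: "a \<noteq> 0" using odd_even_ratio_pos[of n] by (simp add: a_def)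
  have "4 * (real (Suc n))\<^sup>2 = (x + 2)\<^sup>2"
    by (simp add: x_def power2_eq_square algebra_simps)
  moreover have "4 * (real (Suc n))\<^sup>2 - 1 = (x + 1) * (x + 3)"
    by (simp add: x_def power2_eq_square algebra_simps)
  moreover have "odd_even_ratio (Suc n) = a * ((x + 1) / (x + 2))"
    by (simp add: odd_even_ratio_Suc x_def a_def)
  moreover have "2 * real (Suc n) + 1 = x + 3" by (simp add: x_def)
  moreover have "1 / ((x + 1) * a\<^sup>2) * ((x + 2)\<^sup>2 / ((x + 1) * (x + 3)))
      = 1 / ((x + 3) * (a * ((x + 1) / (x + 2)))\<^sup>2)"
    using x a by (simp add: power2_eq_square)
  moreover have "(\<Prod>k=1..n. (4 * (real k)\<^sup>2) / (4 * (real k)\<^sup>2 - 1)) = 1 / ((x + 1) * a\<^sup>2)"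
    using Suc by (simp add: x_def a_def)
  ultimately show ?case by simp
qed

lemma wallis_odd_even_ratio:
  "(\<lambda>n. 1 / ((2 * real n + 1) * (odd_even_ratio n)\<^sup>2)) \<longlonglongrightarrow> pi / 2"
  using wallis by (simp only: wallis_product_eq)

lemma tendsto_n_over_2n_plus_1: "(\<lambda>n. real n / (2 * real n + 1)) \<longlonglongrightarrow> 1 / 2"
proof -
  have "(\<lambda>n. 1 / (2 + inverse (real n))) \<longlonglongrightarrow> 1 / (2 + 0)"
    by (intro tendsto_intros lim_inverse_n) simp
  moreover have "\<forall>\<^sub>F n in sequentially. 1 / (2 + inverse (real n)) = real n / (2 * real n + 1)"
    using eventually_gt_at_top[of 0] by eventually_elim (simp add: field_simps)
  ultimately show ?thesis
    using tendsto_cong by force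
qed

text \<open>Here the critical shift \<open>(2 s - 1) / 4\<close> is 1/4. The limit arises as 1/2
  divided by the Wallis limit \<open>pi / 2\<close>.\<close>

interpretation odd_even: wallis_ratio "\<lambda>n. (odd_even_ratio n)\<^sup>2" 1 "1 / pi"
proof
  have "(\<lambda>n. real n / (2 * real n + 1)
      / (1 / ((2 * real n + 1) * (odd_even_ratio n)\<^sup>2))) \<longlonglongrightarrow> (1 / 2) / (pi / 2)"
    by (intro tendsto_divide tendsto_n_over_2n_plus_1 wallis_odd_even_ratio) simp
  then show "(\<lambda>n. real n * (odd_even_ratio n)\<^sup>2) \<longlonglongrightarrow> 1 / pi"
    by (simp add: add_nonneg_eq_0_iff)
qed (simp_all add: odd_even_ratio_pos odd_even_ratio_pos[THEN less_imp_neq, THEN not_sym]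
    odd_even_ratio_Suc power_mult_distrib power_divide add.assoc)

text \<open>Here the critical shift is 3/4, and the limit is 1/2 times the Wallis limit.\<close>

interpretation even_odd: wallis_ratio "\<lambda>n. (even_odd_ratio n)\<^sup>2" 2 "pi / 4"
proof
  have "(\<lambda>n. real n / (2 * real n + 1)
      * (1 / ((2 * real n + 1) * (odd_even_ratio n)\<^sup>2))) \<longlonglongrightarrow> (1 / 2) * (pi / 2)"
    by (intro tendsto_mult tendsto_n_over_2n_plus_1 wallis_odd_even_ratio)
  then show "(\<lambda>n. real n * (even_odd_ratio n)\<^sup>2) \<longlonglongrightarrow> pi / 4"
    by (simp add: even_odd_ratio_eq power_divide power2_eq_square mult_ac)
qed (simp_all add: even_odd_ratio_pos even_odd_ratio_pos[THEN less_imp_neq, THEN not_sym]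
    even_odd_ratio_Suc power_mult_distrib power_divide add.assoc)

section \<open>Inequalities (I) and (II) and their best constants\<close>

lemma sqrt_divide_le_iff:
  assumes "x > 0" "q > 0"
  shows "sqrt (l / x) \<le> q \<longleftrightarrow> l \<le> q\<^sup>2 * x"
proof -
  have "sqrt (l / x) \<le> q \<longleftrightarrow> sqrt (l / x) \<le> sqrt (q\<^sup>2)" using assms by simp
  also have "\<dots> \<longleftrightarrow> l \<le> q\<^sup>2 * x"
    unfolding real_sqrt_le_iff using assms by (simp add: pos_divide_le_eq)
  finally show ?thesis .
qed

text \<open>As an equivalence this serves four times: directly for the lower bound, negated for the
  upper bound, and likewise for the optimality of both constants.\<close>

lemma odd_even_ratio_ge_iff:
  assumes "real n + c > 0"
  shows "1 / sqrt (pi * (real n + c)) \<le> odd_even_ratio n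
    \<longleftrightarrow> 1 / pi \<le> (odd_even_ratio n)\<^sup>2 * (real n + c)"
  using sqrt_divide_le_iff[OF assms odd_even_ratio_pos, of "1 / pi"]
  by (simp add: real_sqrt_divide real_sqrt_mult)

lemma even_odd_ratio_ge_iff:
  assumes "real n + c > 0"
  shows "sqrt pi / (2 * sqrt (real n + c)) \<le> even_odd_ratio n
    \<longleftrightarrow> pi / 4 \<le> (even_odd_ratio n)\<^sup>2 * (real n + c)"
proof -
  have "sqrt pi / (2 * sqrt x) = sqrt (pi / 4 / x)" for x
    by (simp add: real_sqrt_divide real_sqrt_mult)
  then show ?thesis
    using sqrt_divide_le_iff[OF assms even_odd_ratio_pos] by metis
qed

text \<open>\<open>shift_less\<close> at \<open>n = 1\<close> reads
  \<open>(1/4) (5/4) < 1 / pi\<close>. The result places the lower constant above the critical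
  shift, as \<open>shift_ge\<close> requires.\<close>

lemma quarter_less_4_over_pi_minus_1: "1 / 4 < 4 / pi - 1"
  using odd_even.shift_less[of 1] by (simp add: odd_even_ratio_1 power2_eq_square)

lemma three_quarters_less_9_pi_over_16_minus_1: "3 / 4 < 9 * pi / 16 - 1"
  using even_odd.shift_less[of 1] by (simp add: even_odd_ratio_1 power2_eq_square)

lemma odd_even_ratio_lower:
  assumes "n \<ge> 1"
  shows "1 / sqrt (pi * (real n + (4 / pi - 1))) \<le> odd_even_ratio n"
proof -
  have "1 / pi \<le> (odd_even_ratio n)\<^sup>2 * (real n + (4 / pi - 1))"
    \<comment> \<open>The initial condition of \<open>shift_ge\<close> holds with equality:
      \<open>(1/4) (4 / pi) = 1 / pi\<close>.\<close>
    using assms quarter_less_4_over_pi_minus_1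
    by (intro odd_even.shift_ge) (simp_all add: odd_even_ratio_1 power2_eq_square)
  then show ?thesis
    using quarter_less_4_over_pi_minus_1 by (subst odd_even_ratio_ge_iff) (auto intro: add_nonneg_pos)
qed

lemma odd_even_ratio_upper: "odd_even_ratio n < 1 / sqrt (pi * (real n + 1 / 4))"
  using odd_even_ratio_ge_iff[of n "1 / 4"] odd_even.shift_less[of n] by (simp add: not_le [symmetric])

lemma even_odd_ratio_lower:
  assumes "n \<ge> 1"
  shows "sqrt pi / (2 * sqrt (real n + (9 * pi / 16 - 1))) \<le> even_odd_ratio n"
proof -
  have "pi / 4 \<le> (even_odd_ratio n)\<^sup>2 * (real n + (9 * pi / 16 - 1))"
    using assms three_quarters_less_9_pi_over_16_minus_1
    by (intro even_odd.shift_ge) (simp_all add: even_odd_ratio_1 power2_eq_square)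
  then show ?thesis
    using three_quarters_less_9_pi_over_16_minus_1 by (subst even_odd_ratio_ge_iff) (auto intro: add_nonneg_pos)
qed

lemma even_odd_ratio_upper: "even_odd_ratio n < sqrt pi / (2 * sqrt (real n + 3 / 4))"
  using even_odd_ratio_ge_iff[of n "3 / 4"] even_odd.shift_less[of n] by (simp add: not_le [symmetric])

lemma odd_even_ratio_lower_best:
  assumes "c < 4 / pi - 1"
  shows "\<not> (\<forall>n\<ge>1. 1 / sqrt (pi * (real n + c)) \<le> odd_even_ratio n)"
proof -
  \<comment> \<open>Equality at \<open>n = 1\<close> is what makes the constant optimal.\<close>
  have "(odd_even_ratio 1)\<^sup>2 * (1 + (4 / pi - 1)) = 1 / pi"
    by (simp add: odd_even_ratio_1 power2_eq_square)
  from odd_even.ex_shift_less[OF assms this] show ?thesis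
    using odd_even_ratio_ge_iff by (meson not_le)
qed

lemma odd_even_ratio_upper_best:
  assumes "c > 1 / 4"
  shows "\<not> (\<forall>n\<ge>1. odd_even_ratio n < 1 / sqrt (pi * (real n + c)))"
  using odd_even.ex_shift_ge[of c] assms odd_even_ratio_ge_iff by (auto simp: not_less)

lemma even_odd_ratio_lower_best:
  assumes "c < 9 * pi / 16 - 1"
  shows "\<not> (\<forall>n\<ge>1. sqrt pi / (2 * sqrt (real n + c)) \<le> even_odd_ratio n)"
proof -
  have "(even_odd_ratio 1)\<^sup>2 * (1 + (9 * pi / 16 - 1)) = pi / 4"
    by (simp add: even_odd_ratio_1 power2_eq_square)
  from even_odd.ex_shift_less[OF assms this] show ?thesis
    using even_odd_ratio_ge_iff by (meson not_le)
qed

lemma even_odd_ratio_upper_best: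
  assumes "c > 3 / 4"
  shows "\<not> (\<forall>n\<ge>1. even_odd_ratio n < sqrt pi / (2 * sqrt (real n + c)))"
  using even_odd.ex_shift_ge[of c] assms even_odd_ratio_ge_iff by (auto simp: not_less)

section \<open>Polynomial approximation of the Gaussian\<close>

text \<open>Integration by parts, phrased through the antiderivative
  \<open>x * ?p x ^ Suc m\<close>, yields the recurrence \<open>even_odd_ratio_Suc\<close>.\<close>

lemma has_integral_one_minus_square_power:
  fixes a :: real
  assumes "a > 0"
  shows "((\<lambda>x. (1 - (x / a)\<^sup>2) ^ m) has_integral 2 * a * even_odd_ratio m) {- a..a}"
proof (induction m)
  case 0
  show ?case
    using has_integral_const_real[of "1::real" "- a" a] assms by (simp add: even_odd_ratio_0)
next
  case (Suc m)
  let ?p = "\<lambda>x. 1 - (x / a)\<^sup>2"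
  let ?k = "2 * real m + 2"
  have nz: "2 * real m + 3 \<noteq> 0" by linarith
  have "((\<lambda>x. (?k + 1) * ?p x ^ Suc m - ?k * ?p x ^ m) has_integral
      a * ?p a ^ Suc m - (- a) * ?p (- a) ^ Suc m) {- a..a}"
  proof (rule fundamental_theorem_of_calculus)
    show "- a \<le> a" using assms by simp
    fix x
    have "(?p has_real_derivative - 2 * (x / a) * (1 / a)) (at x within {- a..a})"
      using assms by (auto intro!: derivative_eq_intros)
    from DERIV_mult[OF DERIV_ident DERIV_power[OF this, of "Suc m"]]
    have "((\<lambda>x. x * ?p x ^ Suc m) has_real_derivative
        ?p x ^ Suc m + x * (real (Suc m) * ?p x ^ m * (- 2 * (x / a) * (1 / a)))) (at x within {- a..a})"
      by (simp add: mult_ac)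
    \<comment> \<open>Substituting \<open>(x / a)^2 = 1 - ?p x\<close> leaves only powers of
      \<open>?p x\<close>.\<close>
    also have "?p x ^ Suc m + x * (real (Suc m) * ?p x ^ m * (- 2 * (x / a) * (1 / a)))
        = (?k + 1) * ?p x ^ Suc m - ?k * ?p x ^ m"
      by (simp add: power2_eq_square algebra_simps add_divide_distrib)
    finally show "((\<lambda>x. x * ?p x ^ Suc m) has_vector_derivative
        (?k + 1) * ?p x ^ Suc m - ?k * ?p x ^ m) (at x within {- a..a})"
      unfolding has_real_derivative_iff_has_vector_derivative[symmetric] .
  qed
  \<comment> \<open>The boundary terms vanish since \<open>?p\<close> is 0 at both endpoints and the
    exponent is positive.\<close>
  then have "((\<lambda>x. (?k + 1) * ?p x ^ Suc m - ?k * ?p x ^ m) has_integral 0) {- a..a}"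
    using assms by simp
  from has_integral_add[OF this has_integral_mult_right[OF Suc, of ?k]]
  have "((\<lambda>x. (?k + 1) * ?p x ^ Suc m) has_integral ?k * (2 * a * even_odd_ratio m)) {- a..a}"
    by simp
  from has_integral_mult_right[OF this, of "1 / (?k + 1)"]
  show ?case
    using nz by (simp add: even_odd_ratio_Suc add.assoc mult_ac)
qed

section \<open>The Gaussian integral and inequality (III)\<close>

text \<open>The known half-line moment is doubled by evenness. The upper bound in (III) rests on
  this value.\<close>

lemma gaussian_has_integral: "((\<lambda>x::real. exp (- x\<^sup>2)) has_integral sqrt pi) UNIV"
proof -
  have "has_bochner_integral lborel (\<lambda>x::real. exp (- x\<^sup>2)) (2 * (sqrt pi / 2))"
    using has_bochner_integral_even_function[OF gaussian_moment_0] by simp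
  then show ?thesis
    using has_integral_integral_lborel[of "\<lambda>x::real. exp (- x\<^sup>2)"]
    by (simp add: has_bochner_integral_iff)
qed

lemma gaussian_integrable_on: "(\<lambda>x::real. exp (- x\<^sup>2)) integrable_on {a..b}"
  by (intro integrable_continuous_real continuous_intros)

lemma gaussian_integral_le: "integral {a..b} (\<lambda>x::real. exp (- x\<^sup>2)) \<le> sqrt pi"
proof -
  have "integral {a..b} (\<lambda>x::real. exp (- x\<^sup>2)) \<le> integral UNIV (\<lambda>x::real. exp (- x\<^sup>2))"
    using gaussian_has_integral
    by (intro integral_subset_le gaussian_integrable_on) (auto simp: integrable_on_def)
  also have "\<dots> = sqrt pi"
    using gaussian_has_integral by (rule integral_unique)
  finally show ?thesis .
qed

lemma gaussian_integral_lower: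
  assumes n: "n \<ge> 1"
  shows "sqrt pi / sqrt (1 + (9 * pi / 16 - 1) * (1 / real n))
    \<le> integral {- sqrt (real n)..sqrt (real n)} (\<lambda>x::real. exp (- (x ^ 2)))"
proof -
  let ?a = "sqrt (real n)"
  let ?C = "9 * pi / 16 - 1"
  have a: "?a > 0" using n by simp
  have "1 + ?C * (1 / real n) = (real n + ?C) / real n"
    using n by (simp add: add_divide_distrib)
  \<comment> \<open>The bound is \<open>2 * ?a\<close> times the lower bound in (II), matching the
    polynomial integral with \<open>a = sqrt n\<close> and \<open>m = n\<close>.\<close>
  then have "sqrt pi / sqrt (1 + ?C * (1 / real n)) = 2 * ?a * (sqrt pi / (2 * sqrt (real n + ?C)))"
    by (simp add: real_sqrt_divide)
  also have "\<dots> \<le> 2 * ?a * even_odd_ratio n"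
    using even_odd_ratio_lower[OF n] a by (intro mult_left_mono) auto
  also have "\<dots> \<le> integral {- ?a..?a} (\<lambda>x. exp (- (x ^ 2)))"
  proof (rule has_integral_le[OF has_integral_one_minus_square_power[OF a]
        integrable_integral[OF gaussian_integrable_on]])
    fix x assume "x \<in> {- ?a..?a}"
    \<comment> \<open>This keeps the base \<open>1 - x^2 / n\<close> nonnegative, as the exponential
      inequality requires.\<close>
    then have "x\<^sup>2 \<le> real n" by (auto simp: abs_le_iff intro: sqrt_ge_absD)
    then have "(1 - x\<^sup>2 / real n) ^ n \<le> exp (- x\<^sup>2)"
      using n by (intro exp_ge_one_minus_x_over_n_power_n) auto
    then show "(1 - (x / ?a)\<^sup>2) ^ n \<le> exp (- x\<^sup>2)"
      by (simp add: power_divide)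
  qed
  finally show ?thesis .
qed

text \<open>The integral is at most \<open>sqrt pi\<close>, and dividing \<open>sqrt pi\<close> by a
  root strictly between 0 and 1 enlarges it.\<close>

lemma gaussian_integral_upper:
  assumes n: "n \<ge> 1"
  shows "integral {a..b} (\<lambda>x::real. exp (- (x ^ 2))) < sqrt pi / sqrt (1 - 3 / (4 * real n))"
proof -
  have "3 / (4 * real n) < 1" using n by simp
  moreover have "3 / (4 * real n) > 0" using n by simp
  ultimately have "0 < sqrt (1 - 3 / (4 * real n))" "sqrt (1 - 3 / (4 * real n)) < 1"
    by simp_all
  then have "sqrt pi < sqrt pi / sqrt (1 - 3 / (4 * real n))"
    by (simp add: less_divide_eq)
  with gaussian_integral_le[of a b] show ?thesis by linarith
qed

text \<open>Squeezed between the lower bound of (III) and the constant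
  \<open>sqrt pi\<close>.\<close>

lemma gaussian_integral_tendsto:
  "(\<lambda>n::nat. integral {- sqrt (real n)..sqrt (real n)} (\<lambda>x::real. exp (- (x ^ 2)))) \<longlonglongrightarrow> sqrt pi"
proof (rule tendsto_sandwich)
  have "(\<lambda>n. sqrt pi / sqrt (1 + (9 * pi / 16 - 1) * (1 / real n)))
      \<longlonglongrightarrow> sqrt pi / sqrt (1 + (9 * pi / 16 - 1) * 0)"
    by (intro tendsto_intros lim_1_over_n) simp
  then show "(\<lambda>n. sqrt pi / sqrt (1 + (9 * pi / 16 - 1) * (1 / real n))) \<longlonglongrightarrow> sqrt pi"
    by simp
  show "(\<lambda>n::nat. sqrt pi) \<longlonglongrightarrow> sqrt pi" by simp
  show "\<forall>\<^sub>F n in sequentially. sqrt pi / sqrt (1 + (9 * pi / 16 - 1) * (1 / real n))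
      \<le> integral {- sqrt (real n)..sqrt (real n)} (\<lambda>x::real. exp (- (x ^ 2)))"
    using eventually_ge_at_top[of 1] by eventually_elim (rule gaussian_integral_lower)
qed (simp_all add: gaussian_integral_le)

theorem theorem3:
  shows
    "(\<forall>n::nat. n \<ge> 1 \<longrightarrow>
        1 / sqrt (pi * (real n + (4 / pi - 1))) \<le> real (dfact (2 * n - 1)) / real (dfact (2 * n))
      \<and> real (dfact (2 * n - 1)) / real (dfact (2 * n)) < 1 / sqrt (pi * (real n + 1 / 4)))
   \<and> (\<forall>n::nat. n \<ge> 1 \<longrightarrow>
        sqrt pi / (2 * sqrt (real n + (9 * pi / 16 - 1))) \<le> real (dfact (2 * n)) / real (dfact (2 * n + 1))
      \<and> real (dfact (2 * n)) / real (dfact (2 * n + 1)) < sqrt pi / (2 * sqrt (real n + 3 / 4)))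
   \<and> (\<forall>n::nat. n \<ge> 1 \<longrightarrow>
        sqrt pi / sqrt (1 + (9 * pi / 16 - 1) * (1 / real n))
          \<le> integral {- sqrt (real n)..sqrt (real n)} (\<lambda>x::real. exp (- (x ^ 2)))
      \<and> integral {- sqrt (real n)..sqrt (real n)} (\<lambda>x::real. exp (- (x ^ 2)))
          < sqrt pi / sqrt (1 - 3 / (4 * real n)))
   \<and> (\<lambda>n::nat. integral {- sqrt (real n)..sqrt (real n)} (\<lambda>x::real. exp (- (x ^ 2))))
        \<longlonglongrightarrow> sqrt pi
   \<and> ((\<lambda>x::real. exp (- (x ^ 2))) has_integral sqrt pi) UNIV
   \<and> (\<forall>c::real. c < 4 / pi - 1 \<longrightarrow>
        \<not> (\<forall>n::nat. n \<ge> 1 \<longrightarrow>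
            1 / sqrt (pi * (real n + c)) \<le> real (dfact (2 * n - 1)) / real (dfact (2 * n))))
   \<and> (\<forall>c::real. c > 1 / 4 \<longrightarrow>
        \<not> (\<forall>n::nat. n \<ge> 1 \<longrightarrow>
            real (dfact (2 * n - 1)) / real (dfact (2 * n)) < 1 / sqrt (pi * (real n + c))))
   \<and> (\<forall>c::real. c < 9 * pi / 16 - 1 \<longrightarrow>
        \<not> (\<forall>n::nat. n \<ge> 1 \<longrightarrow>
            sqrt pi / (2 * sqrt (real n + c)) \<le> real (dfact (2 * n)) / real (dfact (2 * n + 1))))
   \<and> (\<forall>c::real. c > 3 / 4 \<longrightarrow>
        \<not> (\<forall>n::nat. n \<ge> 1 \<longrightarrow>
            real (dfact (2 * n)) / real (dfact (2 * n + 1)) < sqrt pi / (2 * sqrt (real n + c))))"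
  unfolding odd_even_ratio_def[symmetric] even_odd_ratio_def[symmetric]
  by (intro conjI allI impI odd_even_ratio_lower odd_even_ratio_upper even_odd_ratio_lower
      even_odd_ratio_upper gaussian_integral_lower gaussian_integral_upper
      gaussian_integral_tendsto gaussian_has_integral odd_even_ratio_lower_best
      odd_even_ratio_upper_best even_odd_ratio_lower_best even_odd_ratio_upper_best)

end
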